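(* Let $G$ be a bi-orderable group, equipped with a bi-ordering $<$, and regard the quandle $\operatorname{Conj}(G)$ as ordered by the same order $<$. Then: (1) There is an embedding of groups $\operatorname{Z}(G)\rtimes\operatorname{Aut}^\circ(G)\hookrightarrow\operatorname{Aut}^\circ(\operatorname{Conj}(G))$. (2) If $G$ has trivial center, then $\operatorname{Aut}^\circ(\operatorname{Conj}(G))=\operatorname{Aut}^\circ(G)$.
   Context: A bi-ordering on a group $G$ is a (strict) linear order $<$ such that $x<y$ implies $zx<zy$ and $xz<yz$ for all $x,y,z\in G$. $\operatorname{Conj}(G)$ is the quandle with underlying set $G$ and operation $x*y=y^{-1}xy$. A quandle automorphism is a bijection preserving $*$. $\operatorname{Z}(G)$ is the center of $G$. $\operatorname{Aut}^\circ(G)$ is the group of group automorphisms of $G$ that preserve $<$, and $\operatorname{Aut}^\circ(\operatorname{Conj}(G))$ is the group of quandle automorphisms of $\operatorname{Conj}(G)$ that preserve $<$. In the semidirect product, $\operatorname{Aut}^\circ(G)$ acts on $\operatorname{Z}(G)$ by restriction of automorphisms. *)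

theory Defs
  imports "HOL-Algebra.Bij"
begin

locale biordered_group = group G
  for G :: "('a, 'b) monoid_scheme" (structure) +
  fixes lt :: "'a \<Rightarrow> 'a \<Rightarrow> bool"  (infix \<open>\<prec>\<close> 50)
  assumes irreflp_less: "irreflp_on (carrier G) (\<prec>)"
    and transp_less: "transp_on (carrier G) (\<prec>)"
    and totalp_less: "totalp_on (carrier G) (\<prec>)"
    and less_mult_left:
      "\<lbrakk>x \<in> carrier G; y \<in> carrier G; z \<in> carrier G; x \<prec> y\<rbrakk> \<Longrightarrow> z \<otimes> x \<prec> z \<otimes> y"
    and less_mult_right:
      "\<lbrakk>x \<in> carrier G; y \<in> carrier G; z \<in> carrier G; x \<prec> y\<rbrakk> \<Longrightarrow> x \<otimes> z \<prec> y \<otimes> z"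

definition center :: "('a, 'b) monoid_scheme \<Rightarrow> 'a set" where
  "center G = {z \<in> carrier G. \<forall>x \<in> carrier G. z \<otimes>\<^bsub>G\<^esub> x = x \<otimes>\<^bsub>G\<^esub> z}"

definition center_group :: "('a, 'b) monoid_scheme \<Rightarrow> ('a, 'b) monoid_scheme" where
  "center_group G = G\<lparr>carrier := center G\<rparr>"

definition semidirect_product ::
    "('n, 'c) monoid_scheme \<Rightarrow> ('h, 'd) monoid_scheme \<Rightarrow> ('h \<Rightarrow> 'n \<Rightarrow> 'n) \<Rightarrow> ('n \<times> 'h) monoid"
  where
  "semidirect_product N H act =
    \<lparr>carrier = carrier N \<times> carrier H,
     mult = (\<lambda>(n, h) (n', h'). (n \<otimes>\<^bsub>N\<^esub> act h n', h \<otimes>\<^bsub>H\<^esub> h')),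
     one = (\<one>\<^bsub>N\<^esub>, \<one>\<^bsub>H\<^esub>)\<rparr>"

record 'a magma = "'a partial_object" +
  qop :: "'a \<Rightarrow> 'a \<Rightarrow> 'a"  (infixl \<open>\<star>\<index>\<close> 70)

locale quandle =
  fixes Q :: "('a, 'b) magma_scheme" (structure)
  assumes qop_closed: "\<lbrakk>x \<in> carrier Q; y \<in> carrier Q\<rbrakk> \<Longrightarrow> x \<star> y \<in> carrier Q"
    and idem: "x \<in> carrier Q \<Longrightarrow> x \<star> x = x"
    and bij_qop_right: "y \<in> carrier Q \<Longrightarrow> bij_betw (\<lambda>x. x \<star> y) (carrier Q) (carrier Q)"
    and self_distrib: "\<lbrakk>x \<in> carrier Q; y \<in> carrier Q; z \<in> carrier Q\<rbrakk>
      \<Longrightarrow> (x \<star> y) \<star> z = (x \<star> z) \<star> (y \<star> z)"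

definition Conj :: "('a, 'b) monoid_scheme \<Rightarrow> 'a magma" where
  "Conj G = \<lparr>carrier = carrier G, qop = (\<lambda>x y. inv\<^bsub>G\<^esub> y \<otimes>\<^bsub>G\<^esub> x \<otimes>\<^bsub>G\<^esub> y)\<rparr>"

lemma carrier_Conj [simp]: "carrier (Conj G) = carrier G"
  by (simp add: Conj_def)

lemma (in group) quandle_Conj: "quandle (Conj G)"
proof
  have cancel: "a \<otimes> (inv a \<otimes> b) = b" "inv a \<otimes> (a \<otimes> b) = b"
    if "a \<in> carrier G" "b \<in> carrier G" for a b
    using that by (simp_all flip: m_assoc)
  fix y assume y: "y \<in> carrier (Conj G)"
  show "bij_betw (\<lambda>x. x \<star>\<^bsub>Conj G\<^esub> y) (carrier (Conj G)) (carrier (Conj G))"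
    by (rule bij_betw_byWitness[where f' = "\<lambda>x. y \<otimes> x \<otimes> inv y"])
      (use y in \<open>auto simp: Conj_def m_assoc cancel\<close>)
next
  have cancel: "a \<otimes> (inv a \<otimes> b) = b" if "a \<in> carrier G" "b \<in> carrier G" for a b
    using that by (simp flip: m_assoc)
  fix x y z assume "x \<in> carrier (Conj G)" "y \<in> carrier (Conj G)" "z \<in> carrier (Conj G)"
  then show "(x \<star>\<^bsub>Conj G\<^esub> y) \<star>\<^bsub>Conj G\<^esub> z
      = (x \<star>\<^bsub>Conj G\<^esub> z) \<star>\<^bsub>Conj G\<^esub> (y \<star>\<^bsub>Conj G\<^esub> z)"
    by (simp add: Conj_def m_assoc inv_mult_group cancel)
qed (auto simp: Conj_def)

text \<open>As in the library's \<^const>\<open>AutoGroup\<close>, automorphisms are normalised to be extensional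
  (\<^const>\<open>undefined\<close> off the carrier), so that equality of maps is equality on the carrier.\<close>

definition quandle_auto :: "('a, 'b) magma_scheme \<Rightarrow> ('a \<Rightarrow> 'a) set" where
  "quandle_auto Q = {f \<in> Bij (carrier Q).
     \<forall>x \<in> carrier Q. \<forall>y \<in> carrier Q. f (x \<star>\<^bsub>Q\<^esub> y) = f x \<star>\<^bsub>Q\<^esub> f y}"

definition ordered_AutoGroup ::
    "('a, 'b) monoid_scheme \<Rightarrow> ('a \<Rightarrow> 'a \<Rightarrow> bool) \<Rightarrow> ('a \<Rightarrow> 'a) monoid" where
  "ordered_AutoGroup G lt = BijGroup (carrier G)
     \<lparr>carrier := {f \<in> auto G. monotone_on (carrier G) lt lt f}\<rparr>"

definition ordered_quandle_AutoGroup ::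
    "('a, 'b) magma_scheme \<Rightarrow> ('a \<Rightarrow> 'a \<Rightarrow> bool) \<Rightarrow> ('a \<Rightarrow> 'a) monoid" where
  "ordered_quandle_AutoGroup Q lt = BijGroup (carrier Q)
     \<lparr>carrier := {f \<in> quandle_auto Q. monotone_on (carrier Q) lt lt f}\<rparr>"

end

theory Submission
  imports Defs
begin

text \<open>
  Multiplying by a central element commutes with conjugation, so \<open>x \<mapsto> z f(x)\<close> is an
  ordered quandle automorphism for central \<open>z\<close> and \<open>f\<close> an ordered group automorphism; its value
  at the identity recovers \<open>z\<close>. Conversely, for a quandle automorphism \<open>f\<close>, conjugating an
  arbitrary \<open>f(w)\<close> by \<open>f(xy)\<close> and by \<open>f(x)f(y)\<close> gives the same result, so these two elements
  differ by a central factor and agree when the center is trivial.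
\<close>

section \<open>Subgroups of the bijection group and order-preserving automorphisms\<close>

lemma Bij_inv_into [simp]:
  assumes "f \<in> Bij S" "x \<in> S"
  shows "inv_into S f x \<in> S" "f (inv_into S f x) = x" "inv_into S f (f x) = x"
  using assms Bij_inv_into_mem[OF assms]
  by (auto simp: Bij_def bij_betw_def f_inv_into_f)

lemma Bij_closed: "f \<in> Bij S \<Longrightarrow> x \<in> S \<Longrightarrow> f x \<in> S"
  using Bij_imp_funcset by blast

text \<open>Multiplication and inversion of \<open>BijGroup\<close> are guarded by membership in
  \<open>Bij S\<close>; discharging the guards once lets later closure proofs deal with plain
  composition and inverse maps.\<close>

lemma subgroup_BijGroupI:
  assumes "H \<subseteq> Bij S" "(\<lambda>x \<in> S. x) \<in> H"
    and "\<And>f g. f \<in> H \<Longrightarrow> g \<in> H \<Longrightarrow> compose S f g \<in> H"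
    and "\<And>f. f \<in> H \<Longrightarrow> restrict (inv_into S f) S \<in> H"
  shows "subgroup H (BijGroup S)"
proof (rule group.subgroupI[OF group_BijGroup])
  fix f assume "f \<in> H"
  then show "inv\<^bsub>BijGroup S\<^esub> f \<in> H"
    using assms inv_BijGroup by (metis subsetD)
next
  fix f g assume "f \<in> H" "g \<in> H"
  then show "f \<otimes>\<^bsub>BijGroup S\<^esub> g \<in> H"
    using assms by (auto simp: BijGroup_def subset_iff)
qed (use assms in \<open>auto simp: BijGroup_def\<close>)

text \<open>Totality is the point for inverses: if two preimages were not in the expected order,
  they would be equal or reversed, and applying \<open>f\<close> would contradict irreflexivity and
  transitivity.\<close>

lemma subgroup_monotone_Bij:
  assumes "irreflp_on S lt" "transp_on S lt" "totalp_on S lt"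
  shows "subgroup {f \<in> Bij S. monotone_on S lt lt f} (BijGroup S)"
proof (rule subgroup_BijGroupI)
  fix f assume f: "f \<in> {f \<in> Bij S. monotone_on S lt lt f}"
  have "lt (inv_into S f x) (inv_into S f y)" if xy: "x \<in> S" "y \<in> S" "lt x y" for x y
  proof (rule ccontr)
    let ?x = "inv_into S f x" and ?y = "inv_into S f y"
    have S: "?x \<in> S" "?y \<in> S" "f ?x = x" "f ?y = y" using f xy by auto
    assume "\<not> lt ?x ?y"
    then have "?x = ?y \<or> lt ?y ?x" using S assms(3) by (auto dest: totalp_onD)
    then have "x = y \<or> lt y x" using f S by (metis (mono_tags, lifting) mem_Collect_eq monotone_onD)
    then show False using xy assms(1,2) by (metis irreflp_onD transp_onD)
  qed
  then show "restrict (inv_into S f) S \<in> {f \<in> Bij S. monotone_on S lt lt f}"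
    using f by (auto simp: restrict_inv_into_Bij intro!: monotone_onI)
qed (auto simp: id_Bij compose_Bij monotone_on_def compose_eq Bij_closed)

lemma (in quandle) subgroup_quandle_auto:
  "subgroup (quandle_auto Q) (BijGroup (carrier Q))"
proof (rule subgroup_BijGroupI)
  fix f assume f: "f \<in> quandle_auto Q"
  then have B: "f \<in> Bij (carrier Q)" by (simp add: quandle_auto_def)
  let ?g = "inv_into (carrier Q) f"
  have "?g (x \<star> y) = ?g x \<star> ?g y" if xy: "x \<in> carrier Q" "y \<in> carrier Q" for x y
  proof -
    have "f (?g x \<star> ?g y) = x \<star> y"
      using f B xy by (simp add: quandle_auto_def)
    then show ?thesis using B xy by (metis qop_closed Bij_inv_into(1,3))
  qed
  then show "restrict ?g (carrier Q) \<in> quandle_auto Q"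
    using B by (simp add: quandle_auto_def restrict_inv_into_Bij qop_closed)
qed (auto simp: quandle_auto_def id_Bij compose_Bij compose_eq Bij_closed qop_closed)

text \<open>An intersection of two subgroups of \<open>BijGroup S\<close>. Both ordered automorphism
  groups are instances, with \<open>H\<close> the group automorphisms or the quandle
  automorphisms.\<close>

lemma group_restrict_Int_monotone:
  assumes "subgroup H (BijGroup S)"
    and "irreflp_on S lt" "transp_on S lt" "totalp_on S lt"
  shows "group (BijGroup S \<lparr>carrier := {f \<in> H. monotone_on S lt lt f}\<rparr>)"
proof -
  have "H \<subseteq> Bij S" using subgroup.subset[OF assms(1)] by (simp add: BijGroup_def)
  then have "{f \<in> H. monotone_on S lt lt f} = H \<inter> {f \<in> Bij S. monotone_on S lt lt f}" by auto
  moreover have "subgroup (H \<inter> {f \<in> Bij S. monotone_on S lt lt f}) (BijGroup S)"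
    using group.subgroups_Inter_pair[OF group_BijGroup assms(1) subgroup_monotone_Bij] assms
    by blast
  ultimately show ?thesis
    using subgroup.subgroup_is_group group_BijGroup by metis
qed

context biordered_group
begin

lemma group_ordered_AutoGroup: "group (ordered_AutoGroup G (\<prec>))"
  unfolding ordered_AutoGroup_def
  using group_restrict_Int_monotone subgroup_auto irreflp_less transp_less totalp_less .

lemma group_ordered_quandle_AutoGroup: "group (ordered_quandle_AutoGroup (Conj G) (\<prec>))"
  unfolding ordered_quandle_AutoGroup_def
  using group_restrict_Int_monotone[OF quandle.subgroup_quandle_auto[OF quandle_Conj]]
    irreflp_less transp_less totalp_less by simp

end

section \<open>Semidirect products\<close>

lemma group_semidirect_product:
  assumes "group N" "group H"
    and hom: "\<And>h. h \<in> carrier H \<Longrightarrow> act h \<in> hom N N"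
    and one: "\<And>n. n \<in> carrier N \<Longrightarrow> act \<one>\<^bsub>H\<^esub> n = n"
    and mult: "\<And>h h' n. \<lbrakk>h \<in> carrier H; h' \<in> carrier H; n \<in> carrier N\<rbrakk>
      \<Longrightarrow> act (h \<otimes>\<^bsub>H\<^esub> h') n = act h (act h' n)"
  shows "group (semidirect_product N H act)"
proof -
  interpret N: group N by fact
  interpret H: group H by fact
  have closed: "act h n \<in> carrier N" if "h \<in> carrier H" "n \<in> carrier N" for h n
    using hom[OF that(1)] that by (auto simp: hom_def)
  have act_mult: "act h (n \<otimes>\<^bsub>N\<^esub> n') = act h n \<otimes>\<^bsub>N\<^esub> act h n'"
    if "h \<in> carrier H" "n \<in> carrier N" "n' \<in> carrier N" for h n n'
    using hom[OF that(1)] that by (auto simp: hom_def)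
  have act_one: "act h \<one>\<^bsub>N\<^esub> = \<one>\<^bsub>N\<^esub>" if "h \<in> carrier H" for h
    using hom_one[OF hom[OF that]] assms by blast
  show ?thesis
  proof (rule groupI)
    fix x assume "x \<in> carrier (semidirect_product N H act)"
    then obtain n h where x: "x = (n, h)" "n \<in> carrier N" "h \<in> carrier H"
      by (auto simp: semidirect_product_def)
    let ?h = "inv\<^bsub>H\<^esub> h"
    \<comment> \<open>This is the first coordinate of the witness below times \<open>x\<close>;
      \<open>groupI\<close> asks for a left inverse only.\<close>
    have "act ?h (inv\<^bsub>N\<^esub> n) \<otimes>\<^bsub>N\<^esub> act ?h n = \<one>\<^bsub>N\<^esub>"
      using x by (simp add: act_one flip: act_mult)
    then show "\<exists>y \<in> carrier (semidirect_product N H act).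
        y \<otimes>\<^bsub>semidirect_product N H act\<^esub> x = \<one>\<^bsub>semidirect_product N H act\<^esub>"
      using x closed
      by (intro bexI[of _ "(act ?h (inv\<^bsub>N\<^esub> n), ?h)"]) (auto simp: semidirect_product_def)
  qed (auto simp: semidirect_product_def closed act_mult one mult N.m_assoc H.m_assoc)
qed

section \<open>The center and the automorphisms of the conjugation quandle\<close>

context group
begin

lemma center_commute: "z \<in> center G \<Longrightarrow> x \<in> carrier G \<Longrightarrow> z \<otimes> x = x \<otimes> z"
  by (simp add: center_def)

lemma subgroup_center: "subgroup (center G) G"
proof (rule subgroupI)
  fix z assume z: "z \<in> center G"
  then have zG: "z \<in> carrier G" by (simp add: center_def)
  have "inv z \<otimes> x = x \<otimes> inv z" if x: "x \<in> carrier G" for x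
  proof -
    have "z \<otimes> x = x \<otimes> z" using z x by (simp add: center_def)
    then have "x = inv z \<otimes> x \<otimes> z" using x zG by (simp add: inv_solve_left m_assoc)
    then show ?thesis using x zG by (subst inv_solve_right) simp_all
  qed
  then show "inv z \<in> center G" using zG by (simp add: center_def)
next
  fix a b assume ab: "a \<in> center G" "b \<in> center G"
  then have G: "a \<in> carrier G" "b \<in> carrier G" by (simp_all add: center_def)
  have "a \<otimes> b \<otimes> x = x \<otimes> (a \<otimes> b)" if x: "x \<in> carrier G" for x
  proof -
    have "a \<otimes> b \<otimes> x = a \<otimes> (x \<otimes> b)"
      using G x by (simp add: m_assoc center_commute[OF ab(2)])
    also have "\<dots> = x \<otimes> a \<otimes> b"
      using G x center_commute[OF ab(1) x] by (simp flip: m_assoc)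
    finally show ?thesis using G x by (simp add: m_assoc)
  qed
  then show "a \<otimes> b \<in> center G" using G by (simp add: center_def)
next
  have "\<one> \<in> center G" by (simp add: center_def)
  then show "center G \<noteq> {}" by blast
qed (simp add: center_def subset_iff)

text \<open>Surjectivity of \<open>f\<close> carries the argument: each \<open>x\<close> is some
  \<open>f y\<close>, and \<open>z\<close> commutes with \<open>y\<close>. This is what makes
  restriction an action on the center.\<close>

lemma auto_center_closed:
  assumes "f \<in> auto G" "z \<in> center G"
  shows "f z \<in> center G"
proof -
  have z: "z \<in> carrier G" and f: "f \<in> Bij (carrier G)" "f \<in> hom G G"
    using assms by (auto simp: center_def auto_def)
  have "f z \<otimes> x = x \<otimes> f z" if x: "x \<in> carrier G" for x
  proof -
    define y where "y = inv_into (carrier G) f x"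
    have y: "y \<in> carrier G" "f y = x" using f x by (simp_all add: y_def)
    then have "f (z \<otimes> y) = f (y \<otimes> z)" using assms(2) by (simp add: center_def)
    then show ?thesis using y z f by (simp add: hom_mult)
  qed
  then show ?thesis using z f by (simp add: center_def Bij_closed)
qed

lemma auto_subset_quandle_auto: "auto G \<subseteq> quandle_auto (Conj G)"
proof
  fix f assume "f \<in> auto G"
  then have f: "f \<in> Bij (carrier G)" "f \<in> hom G G" by (auto simp: auto_def)
  interpret group_hom G G f by unfold_locales (rule f)
  show "f \<in> quandle_auto (Conj G)"
    using f by (simp add: quandle_auto_def Conj_def)
qed

text \<open>Conjugating by \<open>z \<otimes> b\<close> is the same as conjugating by
  \<open>b\<close>, so only the factor \<open>z\<close> on the conjugated element survives, and it
  can be moved to the front.\<close>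

lemma conj_mult_center:
  assumes "z \<in> center G" "a \<in> carrier G" "b \<in> carrier G"
  shows "inv (z \<otimes> b) \<otimes> (z \<otimes> a) \<otimes> (z \<otimes> b) = z \<otimes> (inv b \<otimes> a \<otimes> b)"
proof -
  have z: "z \<in> carrier G" using assms by (simp add: center_def)
  have "inv (z \<otimes> b) \<otimes> (z \<otimes> a) \<otimes> (z \<otimes> b) = inv b \<otimes> (inv z \<otimes> z) \<otimes> a \<otimes> (z \<otimes> b)"
    using assms z by (simp only: inv_mult_group m_assoc m_closed inv_closed)
  also have "\<dots> = (inv b \<otimes> a) \<otimes> z \<otimes> b"
    using assms z by (simp add: m_assoc)
  also have "\<dots> = z \<otimes> (inv b \<otimes> a) \<otimes> b"
    using assms center_commute[OF assms(1), of "inv b \<otimes> a"] by simp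
  finally show ?thesis using assms z by (simp add: m_assoc)
qed

text \<open>Translation by \<open>z\<close> is undone by translation by \<open>inv z\<close>, and
  \<open>conj_mult_center\<close> shows that it respects conjugation.\<close>

lemma center_translate_quandle_auto:
  assumes z: "z \<in> center G" and f: "f \<in> quandle_auto (Conj G)"
  shows "(\<lambda>x \<in> carrier G. z \<otimes> f x) \<in> quandle_auto (Conj G)"
proof -
  have zG: "z \<in> carrier G" using z by (simp add: center_def)
  have B: "f \<in> Bij (carrier G)" using f by (simp add: quandle_auto_def)
  have "bij_betw (\<lambda>x. z \<otimes> x) (carrier G) (carrier G)"
    by (rule bij_betw_byWitness[where f' = "\<lambda>x. inv z \<otimes> x"])
      (use zG in \<open>auto simp flip: m_assoc\<close>)
  moreover have "bij_betw f (carrier G) (carrier G)" using B by (simp add: Bij_def)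
  ultimately have "bij_betw (\<lambda>x. z \<otimes> f x) (carrier G) (carrier G)"
    using bij_betw_trans by (fastforce simp: comp_def)
  then have "(\<lambda>x \<in> carrier G. z \<otimes> f x) \<in> Bij (carrier G)"
    by (simp add: Bij_def bij_betw_restrict_eq)
  then show ?thesis
    using f z B by (simp add: quandle_auto_def Conj_def conj_mult_center Bij_closed)
qed

lemma quandle_auto_centerless:
  assumes triv: "center G = {\<one>}"
  shows "quandle_auto (Conj G) = auto G"
proof (rule equalityI)
  show "quandle_auto (Conj G) \<subseteq> auto G"
  proof
    fix f assume f: "f \<in> quandle_auto (Conj G)"
    then have B: "f \<in> Bij (carrier G)" by (simp add: quandle_auto_def)
    note [simp] = Bij_closed[OF B]
    have conj: "f (inv y \<otimes> x \<otimes> y) = inv (f y) \<otimes> f x \<otimes> f y"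
      if "x \<in> carrier G" "y \<in> carrier G" for x y
      using f that by (simp add: quandle_auto_def Conj_def)
    have "f (x \<otimes> y) = f x \<otimes> f y" if xy: "x \<in> carrier G" "y \<in> carrier G" for x y
    proof -
      define p q where "p = f (x \<otimes> y)" and "q = f x \<otimes> f y"
      have pq: "p \<in> carrier G" "q \<in> carrier G" using xy by (simp_all add: p_def q_def)
      have "p \<otimes> inv q \<otimes> v = v \<otimes> (p \<otimes> inv q)" if v: "v \<in> carrier G" for v
      proof -
        \<comment> \<open>As \<open>f\<close> is onto, the arbitrary \<open>v\<close> is a value
          \<open>f w\<close>, to which \<open>conj\<close> applies.\<close>
        define w where "w = inv_into (carrier G) f v"
        have w: "w \<in> carrier G" "f w = v" using B v by (simp_all add: w_def)
        have "inv p \<otimes> v \<otimes> p = f (inv (x \<otimes> y) \<otimes> w \<otimes> (x \<otimes> y))"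
          using w xy by (simp add: p_def conj)
        \<comment> \<open>Conjugation by a product is done in two stages, so that
          \<open>conj\<close> can be applied once for \<open>y\<close> and once for
          \<open>x\<close>, giving conjugation by \<open>q\<close>.\<close>
        also have "\<dots> = f (inv y \<otimes> (inv x \<otimes> w \<otimes> x) \<otimes> y)"
          using w xy by (simp add: inv_mult_group m_assoc)
        also have "\<dots> = inv q \<otimes> v \<otimes> q"
          using w xy v by (simp only: conj m_closed inv_closed)
            (simp add: q_def inv_mult_group m_assoc)
        \<comment> \<open>The outer factors are chosen so that the sides collapse to
          \<open>v \<otimes> p \<otimes> inv q\<close> and
          \<open>p \<otimes> inv q \<otimes> v\<close>.\<close>
        finally have "p \<otimes> (inv p \<otimes> v \<otimes> p) \<otimes> inv q = p \<otimes> (inv q \<otimes> v \<otimes> q) \<otimes> inv q"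
          by simp
        moreover have "p \<otimes> (inv p \<otimes> a) = a" if "a \<in> carrier G" for a
          using pq that by (simp flip: m_assoc)
        ultimately show ?thesis using pq v by (simp add: m_assoc)
      qed
      then have "p \<otimes> inv q \<in> center G" using pq by (simp add: center_def)
      \<comment> \<open>The central element \<open>p \<otimes> inv q\<close> is
        \<open>\<one>\<close>, so \<open>p\<close> is the inverse of \<open>inv q\<close>.\<close>
      then have "inv (inv q) = p" using triv pq by (intro inv_equality) simp_all
      then show ?thesis using pq by (simp add: p_def q_def)
    qed
    then show "f \<in> auto G" using B by (auto simp: auto_def hom_def)
  qed
qed (rule auto_subset_quandle_auto)

end

section \<open>The embedding of the semidirect product\<close>

context biordered_group
begin

abbreviation (input) center_semidirect :: "('a \<times> ('a \<Rightarrow> 'a)) monoid" where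
  "center_semidirect \<equiv> semidirect_product (center_group G) (ordered_AutoGroup G (\<prec>))
    (\<lambda>f. restrict f (center G))"

lemma group_center_semidirect: "group center_semidirect"
proof (rule group_semidirect_product)
  show "group (center_group G)"
    unfolding center_group_def using subgroup_center subgroup.subgroup_is_group is_group by blast
  have sub: "center G \<subseteq> carrier G" by (auto simp: center_def)
  note closed = subgroup.m_closed[OF subgroup_center]
  fix f assume "f \<in> carrier (ordered_AutoGroup G (\<prec>))"
  then have f: "f \<in> auto G" by (simp add: ordered_AutoGroup_def)
  show "restrict f (center G) \<in> hom (center_group G) (center_group G)"
    using f sub by (auto simp: center_group_def hom_def auto_def closed subset_iff
        intro: auto_center_closed[OF f])
  \<comment> \<open>The nested restrictions evaluate to \<open>f (g z)\<close> because
    \<open>g z\<close> is again central; off the center the outer one would be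
    \<open>undefined\<close>.\<close>
  fix g z assume "g \<in> carrier (ordered_AutoGroup G (\<prec>))" "z \<in> carrier (center_group G)"
  then show "restrict (f \<otimes>\<^bsub>ordered_AutoGroup G (\<prec>)\<^esub> g) (center G) z
      = restrict f (center G) (restrict g (center G) z)"
    using f sub auto_center_closed[of g z]
    by (auto simp: ordered_AutoGroup_def BijGroup_def center_group_def compose_def auto_def)
next
  fix z assume "z \<in> carrier (center_group G)"
  then show "restrict \<one>\<^bsub>ordered_AutoGroup G (\<prec>)\<^esub> (center G) z = z"
    by (auto simp: ordered_AutoGroup_def BijGroup_def center_group_def center_def)
qed (rule group_ordered_AutoGroup)

text \<open>The embedding itself. Restricting to the carrier makes its values extensional, as
  membership in \<open>Bij\<close> demands.\<close>

definition center_translate :: "'a \<times> ('a \<Rightarrow> 'a) \<Rightarrow> 'a \<Rightarrow> 'a" where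
  "center_translate = (\<lambda>(z, f). \<lambda>x \<in> carrier G. z \<otimes> f x)"

lemma center_semidirect_carrier:
  "carrier center_semidirect = center G \<times> {f \<in> auto G. monotone_on (carrier G) (\<prec>) (\<prec>) f}"
  by (simp add: semidirect_product_def center_group_def ordered_AutoGroup_def)

text \<open>Monotonicity comes from left invariance of the order, the quandle part from viewing
  \<open>f\<close> as a quandle automorphism and translating it.\<close>

lemma center_translate_closed:
  assumes "p \<in> carrier center_semidirect"
  shows "center_translate p \<in> carrier (ordered_quandle_AutoGroup (Conj G) (\<prec>))"
proof -
  obtain z f where p: "p = (z, f)" and z: "z \<in> center G" and f: "f \<in> auto G"
    and mono: "monotone_on (carrier G) (\<prec>) (\<prec>) f"
    using assms by (auto simp: center_semidirect_carrier)
  have "f x \<in> carrier G" if "x \<in> carrier G" for x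
    using f that by (auto simp: auto_def Bij_closed)
  then have "monotone_on (carrier G) (\<prec>) (\<prec>) (\<lambda>x \<in> carrier G. z \<otimes> f x)"
    using mono less_mult_left subgroup.mem_carrier[OF subgroup_center z]
    by (auto simp: monotone_on_def)
  then show ?thesis
    using center_translate_quandle_auto[OF z] f auto_subset_quandle_auto
    by (auto simp: p center_translate_def ordered_quandle_AutoGroup_def)
qed

text \<open>Composing the maps of \<open>(z, f)\<close> and \<open>(w, g)\<close> sends
  \<open>x\<close> to \<open>z \<otimes> f (w \<otimes> g x) = (z \<otimes> f w) \<otimes> f (g
  x)\<close>; the twist \<open>f w\<close> is exactly that of the semidirect product.\<close>

lemma group_hom_center_translate:
  "group_hom center_semidirect (ordered_quandle_AutoGroup (Conj G) (\<prec>)) center_translate"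
proof (intro group_hom.intro group_hom_axioms.intro homI)
  fix p q assume pq: "p \<in> carrier center_semidirect" "q \<in> carrier center_semidirect"
  then obtain z f w g where *: "p = (z, f)" "q = (w, g)" "z \<in> center G" "w \<in> center G"
    and f: "f \<in> auto G" and g: "g \<in> auto G"
    by (auto simp: center_semidirect_carrier)
  have G: "z \<in> carrier G" "w \<in> carrier G" "f w \<in> carrier G"
    "\<And>x. x \<in> carrier G \<Longrightarrow> f x \<in> carrier G" "\<And>x. x \<in> carrier G \<Longrightarrow> g x \<in> carrier G"
    "f \<in> hom G G" "f \<in> Bij (carrier G)" "g \<in> Bij (carrier G)"
    using f g subgroup.mem_carrier[OF subgroup_center] *(3,4) by (simp_all add: auto_def Bij_closed)
  \<comment> \<open>Multiplication in \<open>BijGroup\<close> is \<open>undefined\<close> outside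
    \<open>Bij\<close>, so these memberships are needed to unfold it to
    \<open>compose\<close>.\<close>
  have "center_translate p \<in> Bij (carrier G)" "center_translate q \<in> Bij (carrier G)"
    using pq[THEN center_translate_closed]
    by (auto simp: ordered_quandle_AutoGroup_def quandle_auto_def)
  then have "center_translate p \<otimes>\<^bsub>ordered_quandle_AutoGroup (Conj G) (\<prec>)\<^esub> center_translate q
      = compose (carrier G) (center_translate p) (center_translate q)"
    by (simp add: ordered_quandle_AutoGroup_def BijGroup_def)
  moreover have "p \<otimes>\<^bsub>center_semidirect\<^esub> q = (z \<otimes> f w, compose (carrier G) f g)"
    using * G by (simp add: semidirect_product_def center_group_def ordered_AutoGroup_def
        BijGroup_def)
  moreover have "center_translate (z \<otimes> f w, compose (carrier G) f g)
      = compose (carrier G) (center_translate p) (center_translate q)"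
    by (rule ext) (simp add: center_translate_def *(1,2) compose_def m_assoc
        G(1-5) hom_mult[OF G(6)])
  ultimately show "center_translate (p \<otimes>\<^bsub>center_semidirect\<^esub> q)
      = center_translate p \<otimes>\<^bsub>ordered_quandle_AutoGroup (Conj G) (\<prec>)\<^esub> center_translate q"
    by simp
qed (simp_all add: group_center_semidirect group_ordered_quandle_AutoGroup
    center_translate_closed)

lemma inj_on_center_translate: "inj_on center_translate (carrier center_semidirect)"
proof (rule inj_onI)
  fix p q assume "p \<in> carrier center_semidirect" "q \<in> carrier center_semidirect"
    and eq: "center_translate p = center_translate q"
  then obtain z f w g where *: "p = (z, f)" "q = (w, g)" "z \<in> carrier G" "w \<in> carrier G"
    and f: "f \<in> auto G" and g: "g \<in> auto G"
    using subgroup.mem_carrier[OF subgroup_center] by (auto simp: center_semidirect_carrier)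
  have val: "z \<otimes> f x = w \<otimes> g x" if "x \<in> carrier G" for x
    using fun_cong[OF eq, of x] that by (simp add: * center_translate_def)
  \<comment> \<open>Evaluating at the identity isolates the central factors.\<close>
  have "f \<one> = \<one>" "g \<one> = \<one>" using f g hom_one is_group by (auto simp: auto_def)
  then have zw: "z = w" using val[of \<one>] * by simp
  have "f = g"
  \<comment> \<open>Cancelling the common factor gives agreement on the carrier only; extensionality
    supplies the rest.\<close>
  proof (rule extensionalityI)
    show "f \<in> extensional (carrier G)" "g \<in> extensional (carrier G)"
      using f g by (auto simp: auto_def Bij_def)
    show "f x = g x" if "x \<in> carrier G" for x
      using val[OF that] that f g * zw by (auto simp: auto_def Bij_closed)
  qed
  then show "p = q" using * zw by simp
qed

end

theorem proposition4p7:
  fixes G :: "('a, 'b) monoid_scheme" and lt :: "'a \<Rightarrow> 'a \<Rightarrow> bool"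
  assumes "biordered_group G lt"
  shows "(\<exists>\<phi>. group_hom
            (semidirect_product (center_group G) (ordered_AutoGroup G lt)
              (\<lambda>f. restrict f (center G)))
            (ordered_quandle_AutoGroup (Conj G) lt) \<phi> \<and>
          inj_on \<phi> (carrier
            (semidirect_product (center_group G) (ordered_AutoGroup G lt)
              (\<lambda>f. restrict f (center G)))))
       \<and> (center G = {\<one>\<^bsub>G\<^esub>} \<longrightarrow>
            ordered_quandle_AutoGroup (Conj G) lt = ordered_AutoGroup G lt)"
proof -
  interpret biordered_group G lt by fact
  \<comment> \<open>For the centerless case, both groups are \<open>BijGroup (carrier G)\<close>
    with a replaced carrier, so equality of the two automorphism sets suffices.\<close>
  show ?thesis
    using group_hom_center_translate inj_on_center_translate quandle_auto_centerless
    by (auto simp: ordered_quandle_AutoGroup_def ordered_AutoGroup_def)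
qed

end
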